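(* Let $n\ge1$, and let $(c_1,\dots,c_{F_{2n}})=\Pi^\beta_{2n}$ be as defined in the context. Order the points of the orbit $e^{-2\pi i k\varphi}$, $k=1,\dots,F_{2n}$, of $1$ under the circle rotation $z\mapsto z\,e^{-2\pi i\varphi}$ by increasing angle in $[0,2\pi)$, i.e. list $k_1,\dots,k_{F_{2n}}$ so that $\{-k_1\varphi\}<\{-k_2\varphi\}<\dots<\{-k_{F_{2n}}\varphi\}$ (fractional parts). Then $c_j=k_j-1$ for all $j=1,\dots,F_{2n}$.
   Context: Let $\varphi=(1+\sqrt5)/2$. Every integer $N\ge1$ has a unique base phi expansion $N=\sum_{i\in\mathbb Z} d_i\varphi^i$ with $d_i\in\{0,1\}$, finitely many nonzero, $d_id_{i+1}=0$; with $R$ the smallest index with $d_R=1$, $\beta^-(N)=d_{-1}\cdots d_R$. Fibonacci numbers $F_0=0,F_1=1$, $F_n=F_{n-1}+F_{n-2}$; Lucas numbers $L_0=2,L_1=1$, $L_n=L_{n-1}+L_{n-2}$; $\Xi_n=[L_{2n-1}+1,L_{2n+1}]$. For a word $e_k\cdots e_0$ over $\{0,1\}$ with no factor $11$, $Z^{-1}(e_k\cdots e_0)=\sum_i e_iF_{i+2}$ (empty word gives $0$). $\Pi^\beta_{2n}=(c_1,\dots,c_{F_{2n}})$: list the distinct words $\beta^-(N)$, $N\in\Xi_n$, in order of first occurrence as $N$ increases (there are $F_{2n}$ of them), and let $c_j=Z^{-1}$ of the $j$-th word with its final $01$ removed. (E.g. $\Pi^\beta_4=(2,0,1)$, $\Pi^\beta_6=(7,2,5,0,3,6,1,4)$.)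 *)

theory Defs
  imports "HOL-Analysis.Analysis" "HOL-Number_Theory.Fib"
begin

definition golden :: real where
  "golden = (1 + sqrt 5) / 2"

fun lucas :: "nat \<Rightarrow> nat" where
  "lucas 0 = 2"
| "lucas (Suc 0) = 1"
| "lucas (Suc (Suc n)) = lucas (Suc n) + lucas n"

definition is_base_phi :: "(int \<Rightarrow> nat) \<Rightarrow> nat \<Rightarrow> bool" where
  "is_base_phi d N \<longleftrightarrow>
     (\<forall>i. d i \<in> {0, 1}) \<and> finite {i. d i \<noteq> 0} \<and> (\<forall>i. d i * d (i + 1) = 0) \<and>
     real N = (\<Sum>i | d i \<noteq> 0. real (d i) * golden powi i)"

text \<open>The expansion of every \<open>N \<ge> 1\<close> exists and is unique, so the description is proper.\<close>
definition base_phi :: "nat \<Rightarrow> int \<Rightarrow> nat" where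
  "base_phi N = (THE d. is_base_phi d N)"

text \<open>The word \<open>d(-1) d(-2) \<dots> d(R)\<close>, leftmost letter first; it is empty if \<open>R \<ge> 0\<close>.\<close>
definition beta_minus :: "nat \<Rightarrow> nat list" where
  "beta_minus N =
     (let d = base_phi N; R = Min {i. d i = 1}
      in map (\<lambda>k. d (- int k)) [1..<Suc (nat (- R))])"

text \<open>Words are written most significant letter first, so \<open>e\<^sub>i\<close> is the \<open>i\<close>-th letter
  counted from the right, starting at 0.\<close>
definition Z_inv :: "nat list \<Rightarrow> nat" where
  "Z_inv e = (\<Sum>i<length e. rev e ! i * fib (i + 2))"

text \<open>The increasing list of the elements of the interval \<open>[L\<^bsub>2n-1\<^esub> + 1, L\<^bsub>2n+1\<^esub>]\<close>, for \<open>n \<ge> 1\<close>.\<close>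
definition Xi_list :: "nat \<Rightarrow> nat list" where
  "Xi_list n = [lucas (2 * n - 1) + 1 ..< Suc (lucas (2 * n + 1))]"

text \<open>\<^const>\<open>remdups\<close> keeps last occurrences; conjugating with \<^const>\<open>rev\<close> keeps the
  first occurrence of each entry, in order.\<close>
definition first_occurrences :: "'a list \<Rightarrow> 'a list" where
  "first_occurrences xs = rev (remdups (rev xs))"

text \<open>\<open>Pi_beta n\<close> is the sequence with index \<open>2n\<close>. All words \<open>beta_minus N\<close> with \<open>N\<close> in the
  \<open>n\<close>-th interval end in 01; this suffix is removed by dropping the last two letters.\<close>
definition Pi_beta :: "nat \<Rightarrow> nat list" where
  "Pi_beta n =
     map (\<lambda>w. Z_inv (butlast (butlast w))) (first_occurrences (map beta_minus (Xi_list n)))"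

definition rotation :: "complex \<Rightarrow> complex" where
  "rotation z = z * exp (- 2 * of_real pi * \<i> * of_real golden)"

definition orbit_point :: "nat \<Rightarrow> complex" where
  "orbit_point k = (rotation ^^ k) 1"

lemma orbit_point_eq:
  "orbit_point k = exp (- 2 * of_real pi * \<i> * of_nat k * of_real golden)"
proof (induction k)
  case 0
  then show ?case by (simp add: orbit_point_def)
next
  case (Suc k)
  have "orbit_point (Suc k) = rotation (orbit_point k)"
    by (simp add: orbit_point_def)
  also have "\<dots> = exp (- 2 * of_real pi * \<i> * of_nat (Suc k) * of_real golden)"
    by (simp add: Suc rotation_def exp_add [symmetric] algebra_simps)
  finally show ?case .
qed

text \<open>\<open>ks\<close> lists \<open>1, \<dots>, m\<close> so that the points \<open>orbit_point k\<close> have strictly increasing angle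
  in \<open>[0, 2\<pi>)\<close>.\<close>
definition angle_ordering :: "nat \<Rightarrow> nat list \<Rightarrow> bool" where
  "angle_ordering m ks \<longleftrightarrow>
     length ks = m \<and> set ks = {1..m} \<and>
     sorted_wrt (\<lambda>k l. Arg2pi (orbit_point k) < Arg2pi (orbit_point l)) ks"

end

(*
  Let psi = 1 - golden be the conjugate of golden.  An element x of Z[golden] with conjugate y has
  an expansion in nonnegative powers of golden iff x >= 0 and -1 < y < golden.  Conjugating the
  expansion of N turns its negative part into a number B, and N differs from B by the conjugate of
  the nonnegative part: N lies in (B - 1, B + golden), and floor B realizes the same negative part.
  So the words occur first in the order of their values B.  For N in the n-th interval the lowest
  digit sits at -2n, and B = golden^(2n) (1 + s) with s the sum of psi^k over the Zeckendorf
  indices k of c_j.  Because fib k * golden = fib (k + 1) - psi^k, the fractional part of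
  -(c_j + 1) golden is psi^2 + s, so both orders are the order of s.
*)
theory Submission imports Defs begin


section \<open>The golden ratio, its conjugate, and irrationality\<close>

definition psi :: real where
  "psi = 1 - golden"

lemma golden_gt: "golden > 3 / 2"
proof -
  have "2 < sqrt (5 :: real)" by (rule real_less_rsqrt) simp
  then show ?thesis by (simp add: golden_def)
qed

lemma golden_square: "golden * golden = golden + 1"
  by (simp add: golden_def field_simps)

lemma psi_square: "psi * psi = psi + 1"
  using golden_square by (simp add: psi_def algebra_simps)

lemma golden_psi: "golden * psi = - 1"
  using golden_square by (simp add: psi_def algebra_simps)

lemma golden_less: "golden < 2"
proof (rule ccontr)
  assume "\<not> golden < 2"
  then have "golden * 2 \<le> golden * golden" by (intro mult_left_mono) auto
  then show False using golden_square \<open>\<not> golden < 2\<close> golden_gt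
    by (smt (verit) golden_psi psi_def mult_left_mono)
qed

lemma golden_pos [simp]: "golden > 0" and golden_nonzero [simp]: "golden \<noteq> 0"
  and psi_neg [simp]: "psi < 0" and psi_nonzero [simp]: "psi \<noteq> 0"
  using golden_gt by (auto simp: psi_def)

lemma psi_square_bounds: "0 < psi * psi" "psi * psi < 1" "- 1 < psi"
  using golden_gt golden_less psi_square by (auto simp: psi_def)

lemma inverse_golden: "inverse golden = - psi" and inverse_psi: "inverse psi = - golden"
  using golden_psi by (auto simp: field_simps)

text \<open>Irrationality by descent at the prime 2: a zero of the norm form has both coefficients
  even, and halving them gives a smaller zero.\<close>

lemma int_golden_zero:
  fixes a b :: int
  assumes "real_of_int a + real_of_int b * golden = 0"
  shows "a = 0 \<and> b = 0"
proof -
  have parity_descent: "b = 0" if "a * a + a * b = b * b" for a b :: int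
    using that
  proof (induction "nat \<bar>b\<bar>" arbitrary: a b rule: less_induct)
    case less
    have "even (a * a + a * b) \<longleftrightarrow> even (b * b)" using less.prems by simp
    then have "even a" "even b" by auto
    then obtain c d where cd: "a = 2 * c" "b = 2 * d" by (auto elim!: evenE)
    then have "c * c + c * d = d * d" using less.prems by (simp add: algebra_simps)
    then show ?case using less.hyps[of d c] cd by (cases "d = 0") (auto simp: abs_mult)
  qed
  have a: "real_of_int a = - (real_of_int b * golden)" using assms by simp
  have "real_of_int (a * a + a * b)
      = real_of_int b * real_of_int b * (golden * golden - golden)"
    using a by (simp add: algebra_simps)
  also have "\<dots> = real_of_int (b * b)" using golden_square by simp
  finally have "a * a + a * b = b * b" by (simp only: of_int_eq_iff)
  with parity_descent have "b = 0" by blast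
  with a show ?thesis by simp
qed

section \<open>Conjugation in the ring Z[golden]\<close>

text \<open>The graph of the nontrivial automorphism of Z[golden], kept as a relation on the reals;
  \<open>conjugates_unique\<close> shows that it is single valued.\<close>

definition conjugates :: "real \<Rightarrow> real \<Rightarrow> bool" where
  "conjugates x y \<longleftrightarrow>
     (\<exists>a b :: int. x = real_of_int a + real_of_int b * golden \<and> y = real_of_int a + real_of_int b * psi)"

lemma conjugatesI:
  "x = real_of_int a + real_of_int b * golden \<Longrightarrow> y = real_of_int a + real_of_int b * psi \<Longrightarrow> conjugates x y"
  by (auto simp: conjugates_def)

lemma conjugates_of_int [simp]: "conjugates (of_int a) (of_int a)"
  by (rule conjugatesI[of _ a 0]) auto

lemma conjugates_of_nat [simp]: "conjugates (of_nat n) (of_nat n)"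
  using conjugates_of_int[of "int n"] by simp

lemma conjugates_0 [simp]: "conjugates 0 0" and conjugates_1 [simp]: "conjugates 1 1"
  using conjugates_of_int[of 0] conjugates_of_int[of 1] by simp_all

lemma conjugates_golden [simp]: "conjugates golden psi"
  by (rule conjugatesI[of _ 0 1]) auto

text \<open>Replacing \<open>golden\<close> by \<open>1 - psi\<close> sends the coefficients
  \<open>a\<close>, \<open>b\<close> to \<open>a + b\<close>, \<open>- b\<close>.\<close>

lemma conjugates_sym:
  assumes "conjugates x y" shows "conjugates y x"
proof -
  obtain a b :: int where "x = real_of_int a + real_of_int b * golden" "y = real_of_int a + real_of_int b * psi"
    using assms by (auto simp: conjugates_def)
  then show ?thesis by (intro conjugatesI[of _ "a + b" "- b"]) (auto simp: psi_def algebra_simps)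
qed

lemma conjugates_add:
  assumes "conjugates x y" "conjugates u v" shows "conjugates (x + u) (y + v)"
proof -
  obtain a b c d :: int where "x = real_of_int a + real_of_int b * golden" "y = real_of_int a + real_of_int b * psi"
    "u = real_of_int c + real_of_int d * golden" "v = real_of_int c + real_of_int d * psi"
    using assms by (auto simp: conjugates_def)
  then show ?thesis by (intro conjugatesI[of _ "a + c" "b + d"]) (auto simp: algebra_simps)
qed

lemma conjugates_mult:
  assumes "conjugates x y" "conjugates u v" shows "conjugates (x * u) (y * v)"
proof -
  obtain a b c d :: int where *: "x = real_of_int a + real_of_int b * golden" "y = real_of_int a + real_of_int b * psi"
    "u = real_of_int c + real_of_int d * golden" "v = real_of_int c + real_of_int d * psi"
    using assms by (auto simp: conjugates_def)
  \<comment> \<open>The product formula depends on \<open>t\<close> only through its quadratic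
    equation, so both roots get the same integer coefficients.\<close>
  have "(real_of_int a + real_of_int b * t) * (real_of_int c + real_of_int d * t)
      = real_of_int (a * c + b * d) + real_of_int (a * d + b * c + b * d) * t"
    if "t * t = t + 1" for t
  proof -
    have "(real_of_int a + real_of_int b * t) * (real_of_int c + real_of_int d * t)
      = real_of_int a * real_of_int c + (real_of_int a * real_of_int d + real_of_int b * real_of_int c) * t
        + real_of_int b * real_of_int d * (t * t)" by (simp add: algebra_simps)
    then show ?thesis by (simp add: that algebra_simps)
  qed
  then show ?thesis unfolding * using golden_square psi_square by (blast intro: conjugatesI)
qed

lemma conjugates_minus: "conjugates x y \<Longrightarrow> conjugates (- x) (- y)"
  using conjugates_mult[of "- 1" "- 1" x y] conjugates_of_int[of "- 1"] by simp

lemma conjugates_diff: "conjugates x y \<Longrightarrow> conjugates u v \<Longrightarrow> conjugates (x - u) (y - v)"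
  using conjugates_add[of x y "- u" "- v"] conjugates_minus[of u v] by simp

lemma conjugates_sum: "(\<And>i. i \<in> A \<Longrightarrow> conjugates (f i) (g i)) \<Longrightarrow> conjugates (sum f A) (sum g A)"
  by (induction A rule: infinite_finite_induct) (auto intro: conjugates_add)

lemma conjugates_power: "conjugates x y \<Longrightarrow> conjugates (x ^ n) (y ^ n)"
  by (induction n) (auto intro: conjugates_mult)

text \<open>Negative exponents stay inside Z[golden] because \<open>golden\<close> is a unit with
  inverse \<open>- psi\<close>.\<close>

lemma conjugates_powi [simp]: "conjugates (golden powi i) (psi powi i)"
proof (cases i rule: int_cases2)
  case (nonneg n)
  then show ?thesis by (simp add: conjugates_power)
next
  case (nonpos n)
  have "conjugates (- psi) (- golden)"
    by (intro conjugates_minus conjugates_sym[OF conjugates_golden])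
  then show ?thesis
    using conjugates_power[of "- psi" "- golden" n]
    by (simp only: nonpos power_int_minus power_int_of_nat flip: inverse_golden inverse_psi power_inverse)
qed

lemma conjugates_unique:
  assumes "conjugates x y" "conjugates x z" shows "y = z"
proof -
  have "conjugates 0 (y - z)" using conjugates_diff[OF assms] by simp
  then obtain a b :: int where ab: "0 = real_of_int a + real_of_int b * golden" "y - z = real_of_int a + real_of_int b * psi"
    unfolding conjugates_def by blast
  then have "a = 0 \<and> b = 0" using int_golden_zero[of a b] by simp
  with ab show ?thesis by simp
qed

text \<open>The difference \<open>x - y\<close> is \<open>b\<close> times the square root of 5,
  which exceeds 2; the bounds leave only \<open>b = 0\<close>, and then \<open>x = y\<close> is an
  integer in [0, 1).\<close>

lemma conjugates_small_eq_0:
  assumes "conjugates x y" "0 \<le> x" "x < 1" "- 1 < y" "y < golden"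
  shows "x = 0 \<and> y = 0"
proof -
  obtain a b :: int where ab: "x = real_of_int a + real_of_int b * golden" "y = real_of_int a + real_of_int b * psi"
    using assms by (auto simp: conjugates_def)
  have diff: "x - y = real_of_int b * (2 * golden - 1)" using ab by (simp add: psi_def algebra_simps)
  have diff_bounds: "- golden < real_of_int b * (2 * golden - 1)" "real_of_int b * (2 * golden - 1) < 2"
    unfolding diff[symmetric] using assms by linarith+
  have "b < 1"
  proof (rule ccontr)
    assume "\<not> b < 1"
    then have "1 * (2 * golden - 1) \<le> real_of_int b * (2 * golden - 1)"
      using golden_gt by (intro mult_right_mono) auto
    then show False using diff_bounds(2) golden_gt by argo
  qed
  moreover have "b > - 1"
  proof (rule ccontr)
    assume "\<not> b > - 1"
    then have "real_of_int b * (2 * golden - 1) \<le> - 1 * (2 * golden - 1)"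
      using golden_gt by (intro mult_right_mono) auto
    then show False using diff_bounds(1) golden_gt by argo
  qed
  ultimately have "b = 0" by simp
  with ab have "x = real_of_int a" "y = real_of_int a" by auto
  then show ?thesis using assms by simp
qed

section \<open>Digit sets and bounds on their values\<close>

text \<open>A digit string is encoded by the set of positions of its ones. The base is a parameter,
  so one set can be evaluated at \<open>golden\<close> and at its conjugate.\<close>

definition pow_sum :: "real \<Rightarrow> int set \<Rightarrow> real" where
  "pow_sum x S = (\<Sum>i\<in>S. x powi i)"

definition nonadj :: "int set \<Rightarrow> bool" where
  "nonadj S \<longleftrightarrow> finite S \<and> (\<forall>i\<in>S. i + 1 \<notin> S)"

lemma pow_sum_empty [simp]: "pow_sum x {} = 0"
  by (simp add: pow_sum_def)

lemma pow_sum_insert [simp]: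
  "finite S \<Longrightarrow> i \<notin> S \<Longrightarrow> pow_sum x (insert i S) = x powi i + pow_sum x S"
  by (simp add: pow_sum_def)

lemma pow_sum_Un_disjoint:
  "finite S \<Longrightarrow> finite T \<Longrightarrow> S \<inter> T = {} \<Longrightarrow> pow_sum x (S \<union> T) = pow_sum x S + pow_sum x T"
  by (simp add: pow_sum_def sum.union_disjoint)

lemma pow_sum_shift:
  assumes "x \<noteq> 0"
  shows "pow_sum x ((+) k ` S) = x powi k * pow_sum x S"
  using assms by (simp add: pow_sum_def sum.reindex power_int_add sum_distrib_left)

lemma conjugates_pow_sum [simp]: "conjugates (pow_sum golden S) (pow_sum psi S)"
  unfolding pow_sum_def by (rule conjugates_sum) simp

lemma nonadj_finite: "nonadj S \<Longrightarrow> finite S"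
  by (simp add: nonadj_def)

lemma nonadj_subset: "nonadj S \<Longrightarrow> T \<subseteq> S \<Longrightarrow> nonadj T"
  by (auto simp: nonadj_def intro: finite_subset)

lemma nonadj_shift: "nonadj S \<Longrightarrow> nonadj ((+) k ` S)"
  by (force simp: nonadj_def add.assoc)

text \<open>The bounds are the limits of \<open>psi + psi^3 + ...\<close> and
  \<open>1 + psi^2 + ...\<close>. Multiplication by \<open>psi\<close> maps the interval from -1 to
  \<open>golden\<close> onto that from -1 to \<open>golden - 1\<close>, which leaves room for a new
  digit 1 at position 0.\<close>

lemma pow_sum_psi_nonneg_bounds:
  assumes "finite S" "S \<subseteq> {0..}"
  shows "- 1 < pow_sum psi S \<and> pow_sum psi S < golden"
proof -
  have "- 1 < pow_sum psi S \<and> pow_sum psi S < golden" if "S \<subseteq> {0..<int m}" for S m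
    using that
  proof (induction m arbitrary: S)
    case 0
    then show ?case using golden_gt by simp
  next
    case (Suc m)
    define T where "T = (+) (- 1) ` (S - {0})"
    have fin: "finite S" using Suc.prems by (rule finite_subset) simp
    have "T \<subseteq> {0..<int m}" using Suc.prems by (auto simp: T_def)
    from Suc.IH[OF this] have T: "- 1 < pow_sum psi T" "pow_sum psi T < golden" by auto
    have "S - {0} = (+) 1 ` T" by (simp add: T_def image_image)
    then have S0: "pow_sum psi (S - {0}) = psi * pow_sum psi T" by (simp add: pow_sum_shift)
    have "psi * golden < psi * pow_sum psi T" "psi * pow_sum psi T < psi * - 1"
      by (rule mult_strict_left_mono_neg; use T in simp)+
    then have b: "- 1 < pow_sum psi (S - {0})" "pow_sum psi (S - {0}) < golden - 1"
      using S0 golden_psi by (auto simp: mult.commute psi_def)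
    show ?case
    proof (cases "0 \<in> S")
      case True
      then have "pow_sum psi S = 1 + pow_sum psi (S - {0})"
        using pow_sum_insert[of "S - {0}" 0 psi] fin by (simp add: insert_absorb)
      with b show ?thesis by auto
    next
      case False
      with b show ?thesis by auto
    qed
  qed
  \<comment> \<open>Inserting 0 keeps the maximum meaningful when \<open>S\<close> is empty.\<close>
  moreover have "S \<subseteq> {0..<int (nat (Max (insert 0 S) + 1))}"
    using assms by (auto simp: less_le_trans zless_add1_eq)
  ultimately show ?thesis by blast
qed

lemma pow_sum_psi_bounds:
  assumes "finite S" "S \<subseteq> {m..}"
  obtains u where "pow_sum psi S = psi powi m * u" "- 1 < u" "u < golden"
proof
  have "S = (+) m ` (+) (- m) ` S" by (simp add: image_image)
  then show "pow_sum psi S = psi powi m * pow_sum psi ((+) (- m) ` S)"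
    using pow_sum_shift[of psi m "(+) (- m) ` S"] by simp
  have "(+) (- m) ` S \<subseteq> {0..}" using assms by auto
  from pow_sum_psi_nonneg_bounds[OF _ this] show "- 1 < pow_sum psi ((+) (- m) ` S)"
    "pow_sum psi ((+) (- m) ` S) < golden" using assms by auto
qed

text \<open>By nonadjacency the other digits start at \<open>Min S + 2\<close>, so the cofactor is
  \<open>1 + psi * psi * u\<close> with \<open>u\<close> between -1 and \<open>golden\<close>. The
  extreme values are \<open>1 - psi * psi = golden - 1\<close> and
  \<open>1 + psi * psi * golden = golden\<close>.\<close>

lemma pow_sum_psi_Min_bounds:
  assumes "nonadj S" "S \<noteq> {}"
  obtains t where "pow_sum psi S = psi powi Min S * t" "golden - 1 < t" "t < golden"
proof -
  define r where "r = Min S"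
  have fin: "finite S" and r: "r \<in> S" using assms by (auto simp: nonadj_def r_def)
  have "S - {r} \<subseteq> {r + 2..}"
  proof
    fix i assume "i \<in> S - {r}"
    then have "i \<ge> r" "i \<noteq> r" "i \<noteq> r + 1" using assms(1) r fin
      by (auto simp: nonadj_def r_def)
    then show "i \<in> {r + 2..}" by auto
  qed
  with fin obtain u where u: "pow_sum psi (S - {r}) = psi powi (r + 2) * u" "- 1 < u" "u < golden"
    using pow_sum_psi_bounds[of "S - {r}" "r + 2"] by auto
  have "pow_sum psi S = psi powi r + pow_sum psi (S - {r})"
    using pow_sum_insert[of "S - {r}" r psi] fin r by (simp add: insert_absorb)
  also have "\<dots> = psi powi r * (1 + psi * psi * u)"
    using u by (simp add: power_int_add power2_eq_square algebra_simps)
  finally have eq: "pow_sum psi S = psi powi r * (1 + psi * psi * u)" .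
  have "psi * psi * (- 1) < psi * psi * u" "psi * psi * u < psi * psi * golden"
    by (rule mult_strict_left_mono; use u psi_square_bounds in simp)+
  moreover have "psi * psi * golden = - psi" using golden_psi by (metis mult.assoc mult.commute mult_minus1)
  ultimately show ?thesis using that[OF eq[unfolded r_def]] psi_square by (auto simp: psi_def)
qed

section \<open>Existence and uniqueness of expansions\<close>

text \<open>Digits are extracted from position 0 upwards, and the conjugate \<open>y\<close> decides
  each one: 0 below \<open>golden - 1\<close>, 1 above. Subtracting the digit and dividing by
  \<open>golden\<close> lowers the bound on \<open>x\<close> by one power and returns the conjugate
  to the same interval.\<close>

lemma nonneg_expansion_exists:
  assumes "conjugates x y" "0 \<le> x" "x < golden ^ m" "- 1 < y" "y < golden"
  shows "\<exists>S. nonadj S \<and> S \<subseteq> {0..} \<and> pow_sum golden S = x \<and> pow_sum psi S = y"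
  using assms
proof (induction m arbitrary: x y)
  case 0
  then have "x = 0 \<and> y = 0" using conjugates_small_eq_0 by simp
  then show ?case by (intro exI[of _ "{}"]) (auto simp: nonadj_def)
next
  case (Suc m)
  have conj_div: "conjugates (- psi * u) (- golden * v)" if "conjugates u v" for u v
    by (intro conjugates_mult conjugates_minus conjugates_sym[OF conjugates_golden] that)
  have golden_psi_mult: "golden * (psi * u) = - u" for u
    using golden_psi by (simp flip: mult.assoc)
  have psi_golden_mult: "psi * (golden * u) = - u" for u
    using golden_psi_mult[of u] by (simp add: mult.left_commute)
  have bound: "- psi * u < golden ^ m" if "u < golden ^ Suc m" for u
  proof -
    have "- psi * u < - psi * golden ^ Suc m" using that by (intro mult_strict_left_mono) auto
    also have "\<dots> = golden ^ m" by (simp add: psi_golden_mult)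
    finally show ?thesis .
  qed
  consider "y < golden - 1" | "y = golden - 1" | "y > golden - 1" by linarith
  then show ?case
  proof cases
    case 1
    have "golden * y < golden * (golden - 1)" "golden * (- 1) < golden * y"
      by (rule mult_strict_left_mono; use 1 Suc.prems in simp)+
    then have "- 1 < - golden * y" "- golden * y < golden"
      using golden_square by (auto simp: algebra_simps)
    moreover have "0 \<le> - psi * x" using Suc.prems psi_neg
      by (simp add: mult_nonpos_nonneg less_imp_le)
    ultimately obtain S where S: "nonadj S" "S \<subseteq> {0..}" "pow_sum golden S = - psi * x"
      "pow_sum psi S = - golden * y"
      using Suc.IH[OF conj_div[OF Suc.prems(1)] _ bound[OF Suc.prems(3)]] by blast
    show ?thesis
      using S nonadj_shift[of S 1]
      by (intro exI[of _ "(+) 1 ` S"]) (auto simp: pow_sum_shift golden_psi_mult psi_golden_mult)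
  next
    case 2
    \<comment> \<open>Here \<open>y\<close> is \<open>- psi\<close>, whose conjugate
      \<open>- golden\<close> is negative, so the boundary value cannot occur.\<close>
    then have "conjugates (- golden) y"
      using conjugates_minus[OF conjugates_golden] by (simp add: psi_def)
    then have "x = - golden"
      using conjugates_unique conjugates_sym Suc.prems(1) by blast
    then show ?thesis using Suc.prems golden_pos by linarith
  next
    case 3
    have "x \<ge> 1"
      using conjugates_small_eq_0[OF Suc.prems(1)] Suc.prems 3 golden_gt by force
    have "conjugates (x - 1) (y - 1)" using Suc.prems(1) by (intro conjugates_diff) auto
    note c = conj_div[OF this]
    have "golden * (y - 1) < golden * (golden - 1)" "golden * (golden - 2) < golden * (y - 1)"
      by (rule mult_strict_left_mono; use 3 Suc.prems golden_gt in simp)+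
    then have y: "- 1 < - golden * (y - 1)" "- golden * (y - 1) < golden - 1"
      using golden_square by (auto simp: algebra_simps)
    moreover have "0 \<le> - psi * (x - 1)" using \<open>x \<ge> 1\<close> psi_neg
      by (simp add: mult_nonpos_nonneg less_imp_le)
    moreover have "- psi * (x - 1) < golden ^ m" using Suc.prems by (intro bound) auto
    ultimately obtain S where S: "nonadj S" "S \<subseteq> {0..}" "pow_sum golden S = - psi * (x - 1)"
      "pow_sum psi S = - golden * (y - 1)"
      using Suc.IH[OF c] by force
    \<comment> \<open>After a digit 1 the new conjugate lies below \<open>golden - 1\<close>, while
      a one at position 0 of \<open>S\<close> would push it above. Hence the next digit is 0 and
      nonadjacency survives.\<close>
    have "0 \<notin> S"
    proof
      assume "0 \<in> S"
      then have "Min S = 0" using S nonadj_finite by (intro Min_eqI) auto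
      then obtain t where "pow_sum psi S = t" "golden - 1 < t"
        using pow_sum_psi_Min_bounds[OF S(1)] \<open>0 \<in> S\<close> by (metis empty_iff mult_1 power_int_0_right)
      then show False using y S by simp
    qed
    then have notin: "0 \<notin> (+) 1 ` S" "1 \<notin> (+) 1 ` S" "-1 \<notin> (+) 1 ` S" using S by auto
    have nonadj: "nonadj (insert 0 ((+) 1 ` S))"
      using nonadj_shift[OF S(1), of 1] notin by (auto simp: nonadj_def)
    show ?thesis
      using S nonadj nonadj_finite[OF S(1)] notin(1)
      by (intro exI[of _ "insert 0 ((+) 1 ` S)"])
         (auto simp: pow_sum_shift golden_psi_mult psi_golden_mult)
  qed
qed

text \<open>Below the top position \<open>j\<close> nonadjacency leaves only positions less than
  \<open>j - 1\<close>, so by induction the total is less than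
  \<open>golden^j + golden^(j-1) = golden^(j+1)\<close>.\<close>

lemma pow_sum_golden_less:
  assumes "nonadj S" "S \<subseteq> {..<m}"
  shows "pow_sum golden S < golden powi m"
  using assms
proof (induction "card S" arbitrary: S m rule: less_induct)
  case less
  show ?case
  proof (cases "S = {}")
    case True
    then show ?thesis by simp
  next
    case False
    define j where "j = Max S"
    have fin: "finite S" using less.prems by (simp add: nonadj_def)
    then have j: "j \<in> S" "j < m" using less.prems False by (auto simp: j_def)
    have "S - {j} \<subseteq> {..<j - 1}"
    proof
      fix i assume i: "i \<in> S - {j}"
      then have "i \<le> j" "i \<noteq> j" "i + 1 \<noteq> j" using less.prems j fin
        by (auto simp: nonadj_def j_def)
      then show "i \<in> {..<j - 1}" by auto
    qed
    then have "pow_sum golden (S - {j}) < golden powi (j - 1)"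
      using j fin less.prems by (intro less.hyps card_Diff1_less) (auto intro: nonadj_subset)
    moreover have "pow_sum golden S = golden powi j + pow_sum golden (S - {j})"
      using pow_sum_insert[of "S - {j}" j golden] fin j by (simp add: insert_absorb)
    ultimately have "pow_sum golden S < golden powi j + golden powi (j - 1)" by simp
    also have "\<dots> = golden powi (j - 1) * (golden * golden)"
      using power_int_minus_mult[of golden j] by (simp add: golden_square distrib_left)
    also have "\<dots> = golden powi (j + 1)"
      using power_int_add[of golden "j - 1" 2] by (simp add: power2_eq_square add.commute)
    also have "\<dots> \<le> golden powi m"
      using j golden_gt by (intro power_int_increasing) auto
    finally show ?thesis .
  qed
qed

lemma pow_sum_golden_mono:
  "finite T \<Longrightarrow> S \<subseteq> T \<Longrightarrow> pow_sum golden S \<le> pow_sum golden T"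
  unfolding pow_sum_def by (rule sum_mono2) (auto simp: less_imp_le)

text \<open>At the highest position \<open>i\<close> where the sets differ, the one containing
  \<open>i\<close> has at least \<open>golden powi i\<close> from there down, the other strictly
  less by \<open>pow_sum_golden_less\<close>.\<close>

lemma golden_expansion_unique:
  assumes "nonadj S" "nonadj T" "pow_sum golden S = pow_sum golden T"
  shows "S = T"
proof (rule ccontr)
  assume "S \<noteq> T"
  define D where "D = (S - T) \<union> (T - S)"
  have finD: "finite D" "D \<noteq> {}" using assms \<open>S \<noteq> T\<close> by (auto simp: D_def nonadj_def)
  have *: False if "nonadj S" "nonadj T" "pow_sum golden S = pow_sum golden T"
    "i \<in> S" "i \<notin> T" "\<And>j. j > i \<Longrightarrow> j \<in> S \<longleftrightarrow> j \<in> T" for S T and i :: int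
  proof -
    have fin: "finite S" "finite T" using that by (auto simp: nonadj_def)
    have split: "pow_sum golden A = pow_sum golden (A \<inter> {..i}) + pow_sum golden (A \<inter> {i<..})"
      if "finite A" for A
    proof -
      have "A = A \<inter> {..i} \<union> A \<inter> {i<..}" by auto
      also have "pow_sum golden \<dots> = pow_sum golden (A \<inter> {..i}) + pow_sum golden (A \<inter> {i<..})"
        using that by (intro pow_sum_Un_disjoint) auto
      finally show ?thesis .
    qed
    have "S \<inter> {i<..} = T \<inter> {i<..}" using that(6) by auto
    then have "pow_sum golden (S \<inter> {..i}) = pow_sum golden (T \<inter> {..i})"
      using split[OF fin(1)] split[OF fin(2)] that(3) by simp
    moreover have "pow_sum golden {i} \<le> pow_sum golden (S \<inter> {..i})"
      using fin that(4) by (intro pow_sum_golden_mono) auto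
    moreover have "T \<inter> {..i} \<subseteq> {..<i}" using that(5) by (auto simp: less_le)
    then have "pow_sum golden (T \<inter> {..i}) < golden powi i"
      using that(2) by (intro pow_sum_golden_less) (auto intro: nonadj_subset)
    ultimately show False by (simp add: pow_sum_def)
  qed
  have "Max D \<in> D" using finD by simp
  moreover have "j \<in> S \<longleftrightarrow> j \<in> T" if "j > Max D" for j
  proof -
    have "j \<notin> D" using that finD(1) Max_ge leD by blast
    then show ?thesis by (auto simp: D_def)
  qed
  ultimately show False
    using *[of S T "Max D"] *[of T S "Max D"] assms by (auto simp: D_def)
qed

text \<open>Multiplying by \<open>golden ^ (2 * m)\<close> shrinks the conjugate to
  \<open>psi ^ (2 * m) * N\<close>, which the choice of \<open>m\<close> puts below 1 and the even
  exponent keeps nonnegative. The digits found there are shifted back by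
  \<open>2 * m\<close>.\<close>

lemma golden_expansion_exists:
  "\<exists>S. nonadj S \<and> pow_sum golden S = real N"
proof -
  obtain m where m: "real N < golden ^ m"
    using real_arch_pow[of golden] golden_gt by force
  have le: "golden ^ m \<le> golden ^ (2 * m)" using golden_gt by (intro power_increasing) auto
  have "(psi ^ m * golden ^ m) ^ 2 = 1"
    using golden_psi by (simp add: power_mult_distrib[symmetric] mult.commute) 
      (simp add: power_mult_distrib flip: power_mult)
  then have inv: "psi ^ (2 * m) * golden ^ (2 * m) = 1"
    by (simp add: power_mult_distrib power_mult mult.commute flip: power_mult)
  have "psi ^ (2 * m) * real N < psi ^ (2 * m) * golden ^ (2 * m)"
    using m le by (intro mult_strict_left_mono) (auto simp: zero_less_power_eq)
  then have "psi ^ (2 * m) * real N < golden" using inv golden_gt by simp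
  moreover have "psi ^ (2 * m) * real N \<ge> 0" by (simp add: zero_le_even_power)
  moreover obtain k where "golden ^ (2 * m) * real N < golden ^ k"
    using real_arch_pow[of golden] golden_gt by force
  moreover have "conjugates (golden ^ (2 * m) * real N) (psi ^ (2 * m) * real N)"
    by (intro conjugates_mult conjugates_power) auto
  moreover have "0 \<le> golden ^ (2 * m) * real N" by (simp add: less_imp_le)
  ultimately obtain S where S: "nonadj S" "pow_sum golden S = golden ^ (2 * m) * real N"
    using nonneg_expansion_exists[of "golden ^ (2 * m) * real N" "psi ^ (2 * m) * real N" k]
    by (auto simp: less_le_trans[of _ 0])
  have "pow_sum golden ((+) (- int (2 * m)) ` S) = golden powi (- int (2 * m)) * (golden ^ (2 * m) * real N)"
    using S by (subst pow_sum_shift) auto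
  also have "\<dots> = real N" by (simp only: power_int_minus power_int_of_nat) simp
  finally show ?thesis using nonadj_shift[OF S(1)] by blast
qed


section \<open>The base phi digits of a natural number\<close>

lemma base_phi_eqI:
  assumes "nonadj S" "pow_sum golden S = real N"
  shows "base_phi N = (\<lambda>i. of_bool (i \<in> S))"
  unfolding base_phi_def
proof (rule the_equality)
  have "{i. of_bool (i \<in> S) \<noteq> (0 :: nat)} = S" by auto
  then show "is_base_phi (\<lambda>i. of_bool (i \<in> S)) N"
    using assms by (auto simp: is_base_phi_def nonadj_def pow_sum_def of_bool_def)
next
  fix d assume d: "is_base_phi d N"
  define T where "T = {i. d i \<noteq> 0}"
  have d01: "d i = of_bool (i \<in> T)" for i
  proof -
    have "d i \<in> {0, 1}" using d by (simp add: is_base_phi_def)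
    then show ?thesis by (auto simp: T_def)
  qed
  have adj: "\<forall>i. d i * d (i + 1) = 0" and fin: "finite T"
    and sum: "real N = (\<Sum>i\<in>T. real (d i) * golden powi i)"
    using d by (simp_all add: is_base_phi_def T_def)
  have "nonadj T" using adj fin by (auto simp: nonadj_def T_def mult_eq_0_iff) (metis neq0_conv)
  moreover have "pow_sum golden T = real N"
    using sum by (simp add: pow_sum_def d01)
  ultimately have "T = S" using golden_expansion_unique assms by simp
  with d01 show "d = (\<lambda>i. of_bool (i \<in> S))" by auto
qed

definition phi_digits :: "nat \<Rightarrow> int set" where
  "phi_digits N = {i. base_phi N i = 1}"

lemma phi_digits_eqI: "nonadj S \<Longrightarrow> pow_sum golden S = real N \<Longrightarrow> phi_digits N = S"
  by (simp add: phi_digits_def base_phi_eqI)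

lemma phi_digits:
  shows nonadj_phi_digits: "nonadj (phi_digits N)"
    and pow_sum_golden_phi_digits: "pow_sum golden (phi_digits N) = real N"
  using golden_expansion_exists[of N] phi_digits_eqI by auto

lemma base_phi_eq: "base_phi N i = of_bool (i \<in> phi_digits N)"
  using base_phi_eqI[OF phi_digits] by simp

text \<open>A natural number is its own conjugate, so the same digits represent it in base
  \<open>psi\<close>, where the negative positions carry the large terms.\<close>

lemma pow_sum_psi_phi_digits: "pow_sum psi (phi_digits N) = real N"
  using conjugates_unique[OF conjugates_pow_sum[of "phi_digits N"], of "real N"]
  by (simp add: pow_sum_golden_phi_digits)

lemma phi_digits_nonempty: "N \<ge> 1 \<Longrightarrow> phi_digits N \<noteq> {}"
  using pow_sum_golden_phi_digits[of N] by auto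

lemma psi_powi: "psi powi i = (if even i then golden powi (- i) else - (golden powi (- i)))"
proof -
  have "psi powi i = (- inverse golden) powi i" by (simp add: inverse_golden)
  then show ?thesis by (auto simp: power_int_minus_left power_int_inverse power_int_minus)
qed

text \<open>Here \<open>N\<close> is \<open>psi powi r\<close> times a factor between
  \<open>golden - 1\<close> and \<open>golden\<close>. Positivity forces \<open>r\<close> to be
  even, and the window follows because \<open>golden - 1\<close> is
  \<open>1 / golden\<close>.\<close>

lemma phi_digits_Min:
  assumes "N \<ge> 1"
  defines "r \<equiv> Min (phi_digits N)"
  shows "even r" "golden powi (- r - 1) < real N" "real N < golden powi (- r + 1)"
proof -
  obtain t where t: "real N = psi powi r * t" "golden - 1 < t" "t < golden"
    using pow_sum_psi_Min_bounds[OF nonadj_phi_digits phi_digits_nonempty[OF assms(1)]]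
    by (metis pow_sum_psi_phi_digits r_def)
  have "t > 0" using t golden_gt by simp
  have "psi powi r > 0" using t(1) \<open>t > 0\<close> assms(1)
    by (metis less_le_trans of_nat_0_less_iff zero_less_mult_pos2 zero_less_one)
  then show "even r" using zero_less_power_int[OF golden_pos, of "- r"] psi_powi[of r]
    by (metis less_asym neg_less_0_iff_less)
  then have N: "real N = golden powi (- r) * t" using t by (simp add: psi_powi)
  have "golden powi (- r) * (golden - 1) = golden powi (- r - 1)"
    using inverse_golden power_int_diff[of golden "- r" 1] by (simp add: psi_def divide_inverse)
  then show "golden powi (- r - 1) < real N"
    unfolding N using t(2) by (metis golden_pos mult_less_cancel_left_pos zero_less_power_int)
  show "real N < golden powi (- r + 1)"
    unfolding N using t(3) power_int_add_1[of golden "- r"]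
    by (metis golden_nonzero golden_pos mult_less_cancel_left_pos zero_less_power_int)
qed

section \<open>Lucas intervals and the lowest digit\<close>

lemma lucas_eq: "real (lucas m) = golden ^ m + psi ^ m"
proof (induction m rule: lucas.induct)
  case (3 n)
  have rec: "t ^ Suc (Suc n) = t ^ Suc n + t ^ n" if "t * t = t + 1" for t :: real
    using that by (simp add: distrib_left algebra_simps flip: mult.assoc)
  show ?case using 3 rec[OF golden_square] rec[OF psi_square] by simp
qed (auto simp: psi_def)

text \<open>For odd \<open>m\<close> the correction \<open>psi ^ m\<close> lies between -1 and 0, so
  the Lucas number is the integer part of \<open>golden ^ m\<close>.\<close>

lemma lucas_odd_bounds:
  assumes "odd m"
  shows "golden ^ m - 1 < real (lucas m)" "real (lucas m) < golden ^ m"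
proof -
  have "psi ^ m < 0" using assms by (simp add: power_less_zero_eq)
  moreover have "\<bar>psi\<bar> ^ m < 1"
    using psi_square_bounds(3) psi_neg assms
    by (intro power_less_one_iff[THEN iffD2]) (auto simp: odd_pos abs_less_iff intro: less_trans[OF psi_neg])
  then have "\<bar>psi ^ m\<bar> < 1" by (simp add: power_abs)
  ultimately show "golden ^ m - 1 < real (lucas m)" "real (lucas m) < golden ^ m"
    by (auto simp: lucas_eq)
qed

lemma set_Xi_list_iff:
  assumes "n \<ge> 1"
  shows "N \<in> set (Xi_list n) \<longleftrightarrow> golden powi (2 * int n - 1) < real N \<and> real N < golden powi (2 * int n + 1)"
proof -
  have lower: "lucas m + 1 \<le> N \<longleftrightarrow> golden ^ m < real N" if "odd m" for m
    using lucas_odd_bounds[OF that] by linarith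
  have upper: "N \<le> lucas m \<longleftrightarrow> real N < golden ^ m" if "odd m" for m
    using lucas_odd_bounds[OF that] by linarith
  have "golden powi (2 * int n - 1) = golden ^ (2 * n - 1)" "golden powi (2 * int n + 1) = golden ^ (2 * n + 1)"
    using assms by (simp_all add: of_nat_diff add.commute flip: power_int_of_nat)
  then show ?thesis
    using lower[of "2 * n - 1"] upper[of "2 * n + 1"] assms by (auto simp: Xi_list_def less_Suc_eq_le)
qed

text \<open>The windows of \<open>phi_digits_Min\<close> for distinct even \<open>r\<close> do not
  overlap, and the \<open>n\<close>-th interval is the window of \<open>r = - 2 * n\<close>.\<close>

lemma set_Xi_list_iff_Min:
  assumes "n \<ge> 1"
  shows "N \<in> set (Xi_list n) \<longleftrightarrow> N \<ge> 1 \<and> Min (phi_digits N) = - 2 * int n"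
proof
  assume N: "N \<ge> 1 \<and> Min (phi_digits N) = - 2 * int n"
  then show "N \<in> set (Xi_list n)"
    using phi_digits_Min[of N] assms by (simp add: set_Xi_list_iff)
next
  assume N: "N \<in> set (Xi_list n)"
  have N1: "N \<ge> 1" using N by (auto simp: Xi_list_def)
  define r where "r = Min (phi_digits N)"
  have *: "a < b" if "golden powi a < golden powi b" for a b
  proof (rule ccontr)
    assume "\<not> a < b"
    then have "golden powi b \<le> golden powi a" using golden_gt by (intro power_int_increasing) auto
    with that show False by simp
  qed
  have "golden powi (2 * int n - 1) < golden powi (- r + 1)" "golden powi (- r - 1) < golden powi (2 * int n + 1)"
    using N phi_digits_Min[OF N1] unfolding r_def set_Xi_list_iff[OF assms] by linarith+
  with * have "2 * int n - 1 < - r + 1" "- r - 1 < 2 * int n + 1" by blast+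
  moreover have "even r" using phi_digits_Min[OF N1] by (simp add: r_def)
  ultimately show "N \<ge> 1 \<and> Min (phi_digits N) = - 2 * int n"
    using N1 by (auto simp: r_def elim!: evenE)
qed

section \<open>The negative part of an expansion and its realizations\<close>

text \<open>The shift by \<open>2 * n\<close> turns a negative position into the index of the
  Fibonacci number that it contributes to \<open>Z_inv\<close>. Indices 0 and 1 are left out: they
  are the lowest digit and its empty neighbour, the removed suffix 01.\<close>

definition tail :: "nat \<Rightarrow> nat \<Rightarrow> int set" where
  "tail n N = {k. 2 \<le> k \<and> k < 2 * int n \<and> k - 2 * int n \<in> phi_digits N}"

lemma tail_subset: "tail n N \<subseteq> {2..<2 * int n}"
  by (auto simp: tail_def)

lemma nonadj_tail: "nonadj (tail n N)"
proof -
  have "(+) (- 2 * int n) ` tail n N \<subseteq> phi_digits N" by (auto simp: tail_def)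
  then have "nonadj ((+) (- 2 * int n) ` tail n N)" using nonadj_phi_digits nonadj_subset by blast
  from nonadj_shift[OF this, of "2 * int n"] show ?thesis by (simp add: image_image)
qed

definition neg_digits :: "nat \<Rightarrow> int set \<Rightarrow> int set" where
  "neg_digits n E = insert (- 2 * int n) ((+) (- 2 * int n) ` E)"

text \<open>The factor is \<open>psi powi (- 2 * n)\<close>, positive because the exponent is even.
  This value is the number B by which tails are compared.\<close>

lemma pow_sum_neg_digits:
  assumes "finite E" "E \<subseteq> {2..}"
  shows "pow_sum psi (neg_digits n E) = golden ^ (2 * n) * (1 + pow_sum psi E)"
proof -
  have "- 2 * int n \<notin> (+) (- 2 * int n) ` E" using assms by auto
  moreover have "psi powi (- 2 * int n) = golden ^ (2 * n)"
    by (simp add: psi_powi flip: power_int_of_nat)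
  ultimately show ?thesis
    using assms pow_sum_shift[of psi "- 2 * int n" E]
    unfolding neg_digits_def by (simp add: distrib_left)
qed

lemma nonadj_neg_digits:
  assumes "nonadj E" "E \<subseteq> {2..}"
  shows "nonadj (neg_digits n E)"
  using nonadj_shift[OF assms(1), of "- 2 * int n"] assms(2)
  by (auto simp: nonadj_def neg_digits_def)

lemma Xi_digits:
  assumes "n \<ge> 1" "N \<in> set (Xi_list n)"
  shows "- 2 * int n \<in> phi_digits N" "- 2 * int n + 1 \<notin> phi_digits N"
    "\<And>i. i \<in> phi_digits N \<Longrightarrow> - 2 * int n \<le> i"
    "phi_digits N = neg_digits n (tail n N) \<union> (phi_digits N \<inter> {0..})"
proof -
  have N: "N \<ge> 1" and Min: "Min (phi_digits N) = - 2 * int n"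
    using assms by (auto simp: set_Xi_list_iff_Min)
  have fin: "finite (phi_digits N)" by (simp add: nonadj_finite nonadj_phi_digits)
  show 1: "- 2 * int n \<in> phi_digits N"
    using Min_in[OF fin phi_digits_nonempty[OF N]] Min by simp
  show 2: "- 2 * int n + 1 \<notin> phi_digits N"
    using 1 nonadj_phi_digits unfolding nonadj_def by blast
  show 3: "- 2 * int n \<le> i" if "i \<in> phi_digits N" for i
    using Min_le[OF fin that] Min by simp
  have "i \<in> neg_digits n (tail n N)" if "i \<in> phi_digits N" "i < 0" for i
  proof (cases "i = - 2 * int n")
    case False
    then have "i \<ge> - 2 * int n + 2"
    proof -
      have "i \<noteq> - 2 * int n + 1" using 2 that(1) by blast
      then show ?thesis using False 3[OF that(1)] by linarith
    qed
    then have "i + 2 * int n \<in> tail n N" using that by (auto simp: tail_def)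
    then show ?thesis unfolding neg_digits_def by (intro insertI2 image_eqI[of _ _ "i + 2 * int n"]) auto
  qed (simp add: neg_digits_def)
  moreover have "neg_digits n (tail n N) \<subseteq> phi_digits N" using 1 by (auto simp: neg_digits_def tail_def)
  ultimately show "phi_digits N = neg_digits n (tail n N) \<union> (phi_digits N \<inter> {0..})"
    by force
qed

text \<open>In base \<open>psi\<close> the negative digits of \<open>N\<close> contribute the
  left-hand side, and the nonnegative ones contribute more than -1.\<close>

lemma tail_upper_bound:
  assumes "n \<ge> 1" "N \<in> set (Xi_list n)"
  shows "golden ^ (2 * n) * (1 + pow_sum psi (tail n N)) < real N + 1"
proof -
  have fin: "finite (phi_digits N)" by (simp add: nonadj_finite nonadj_phi_digits)
  have finE: "finite (tail n N)" by (simp add: nonadj_finite nonadj_tail)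
  have E: "tail n N \<subseteq> {2..}" using tail_subset by force
  have disj: "neg_digits n (tail n N) \<inter> (phi_digits N \<inter> {0..}) = {}"
    using tail_subset[of n N] assms(1) by (auto simp: neg_digits_def)
  have "real N = pow_sum psi (neg_digits n (tail n N) \<union> (phi_digits N \<inter> {0..}))"
    using pow_sum_psi_phi_digits Xi_digits(4)[OF assms] by simp
  also have "\<dots> = pow_sum psi (neg_digits n (tail n N)) + pow_sum psi (phi_digits N \<inter> {0..})"
    using fin finE disj by (intro pow_sum_Un_disjoint) (auto simp: neg_digits_def)
  finally show ?thesis
    using pow_sum_psi_nonneg_bounds[of "phi_digits N \<inter> {0..}"] fin pow_sum_neg_digits[OF finE E, of n]
    by simp
qed

text \<open>The witness \<open>M\<close> is the integer part of B. Since \<open>M - B\<close> lies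
  in (-1, 0], the number \<open>M - pow_sum golden S\<close> has an expansion in nonnegative
  positions, which completes \<open>S\<close> to the digits of \<open>M\<close>. The bound on
  \<open>M\<close> later forces an early first occurrence.\<close>

lemma tail_realized:
  assumes n: "n \<ge> 1" and E: "nonadj E" "E \<subseteq> {2..<2 * int n}"
  obtains M where "M \<in> set (Xi_list n)" "tail n M = E"
    "real M \<le> golden ^ (2 * n) * (1 + pow_sum psi E)"
proof -
  define S where "S = neg_digits n E"
  define B where "B = pow_sum psi S"
  have E2: "E \<subseteq> {2..}" using E by auto
  have finE: "finite E" using E by (simp add: nonadj_finite)
  have B: "B = golden ^ (2 * n) * (1 + pow_sum psi E)"
    unfolding B_def S_def by (rule pow_sum_neg_digits[OF finE E2])
  have S: "nonadj S" unfolding S_def by (rule nonadj_neg_digits[OF E(1) E2])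
  have finS: "finite S" and Sneg: "S \<subseteq> {..<0}" using E n finE by (auto simp: S_def neg_digits_def)
  have MinS: "Min S = - 2 * int n"
    using E finS by (intro Min_eqI) (auto simp: S_def neg_digits_def)
  have "S \<noteq> {}" by (auto simp: S_def neg_digits_def)
  then obtain t where t: "B = psi powi (- 2 * int n) * t" "golden - 1 < t"
    using pow_sum_psi_Min_bounds[OF S] unfolding B_def MinS by metis
  have "psi powi (- 2 * int n) = golden ^ (2 * n)"
    by (simp add: psi_powi flip: power_int_of_nat)
  then have B_t: "B = golden ^ (2 * n) * t" using t by simp
  have "golden ^ (2 * n) * (golden - 1) < B"
    unfolding B_t using t by (intro mult_strict_left_mono) auto
  moreover have "golden ^ (2 * n) * (golden - 1) = golden ^ (2 * n - 1)"
  proof -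
    have "golden ^ (2 * n) * (golden - 1) = golden ^ (2 * n - 1) * (golden * (golden - 1))"
      using n by (simp add: power_eq_if)
    then show ?thesis using golden_square by (simp add: algebra_simps)
  qed
  moreover have "1 \<le> golden ^ (2 * n - 1)" using golden_gt by (intro one_le_power) auto
  ultimately have "B > 1" by linarith
  define M where "M = nat \<lfloor>B\<rfloor>"
  have M: "real M \<le> B" "B < real M + 1" "M \<ge> 1"
    using \<open>B > 1\<close> by (auto simp: M_def le_nat_iff le_floor_iff)
  \<comment> \<open>Negative positions are worth less than 1 in base \<open>golden\<close>, so
    \<open>M \<ge> 1\<close> makes the remainder nonnegative.\<close>
  have "pow_sum golden S < golden powi 0" by (rule pow_sum_golden_less[OF S Sneg])
  then have "0 \<le> real M - pow_sum golden S" using M(3) by simp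
  moreover obtain m where "real M - pow_sum golden S < golden ^ m"
    using real_arch_pow[of golden] golden_gt by force
  moreover have "conjugates (real M - pow_sum golden S) (real M - B)"
    unfolding B_def by (intro conjugates_diff) auto
  ultimately obtain T where T: "nonadj T" "T \<subseteq> {0..}" "pow_sum golden T = real M - pow_sum golden S"
    "pow_sum psi T = real M - B"
    using nonneg_expansion_exists[of "real M - pow_sum golden S" "real M - B" m] M golden_gt by force
  have finT: "finite T" using T by (simp add: nonadj_finite)
  \<comment> \<open>The conjugate of \<open>T\<close> is \<open>\<le> 0\<close>, which leaves no room for the digit at position 0.\<close>
  have "0 \<notin> T"
  proof
    assume "0 \<in> T"
    then have "Min T = 0" using T finT by (intro Min_eqI) auto
    then obtain t where "pow_sum psi T = t" "golden - 1 < t"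
      using pow_sum_psi_Min_bounds[OF T(1)] \<open>0 \<in> T\<close> by (metis empty_iff mult_1 power_int_0_right)
    then show False using T M golden_gt by simp
  qed
  \<comment> \<open>Between the two parts only positions -1 and 0 could be neighbours, and
    \<open>0 \<notin> T\<close> excludes this.\<close>
  have "nonadj (S \<union> T)"
    unfolding nonadj_def
  proof (intro conjI ballI)
    fix i assume i: "i \<in> S \<union> T"
    show "i + 1 \<notin> S \<union> T"
    proof
      assume i1: "i + 1 \<in> S \<union> T"
      have "i = - 1" if "i \<in> S" "i + 1 \<in> T" using that Sneg T(2) by force
      moreover have "\<not> (i \<in> T \<and> i + 1 \<in> S)" using Sneg T(2) by force
      ultimately show False using i i1 S T(1) \<open>0 \<notin> T\<close> unfolding nonadj_def by auto
    qed
  qed (use finS finT in simp)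
  moreover have "S \<inter> T = {}" using Sneg T by force
  then have "pow_sum golden (S \<union> T) = real M"
    using finS finT T by (simp add: pow_sum_Un_disjoint)
  ultimately have digits: "phi_digits M = S \<union> T" by (rule phi_digits_eqI)
  have "Min (S \<union> T) = - 2 * int n"
    using E finS finT T by (intro Min_eqI) (auto simp: S_def neg_digits_def)
  then have "M \<in> set (Xi_list n)" using M digits n by (simp add: set_Xi_list_iff_Min)
  moreover have "tail n M = E"
    unfolding tail_def digits using E T by (auto simp: S_def neg_digits_def)
  ultimately show thesis using that M(1) B by simp
qed

section \<open>Words and their Zeckendorf values\<close>

text \<open>The lowest digit sits at \<open>- 2 * n\<close> with an empty place above it. So all
  words of the interval have the same length and suffix and depend on \<open>N\<close> only through
  its tail.\<close>

lemma beta_minus_Xi: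
  assumes "n \<ge> 1" "N \<in> set (Xi_list n)"
  shows "beta_minus N = map (\<lambda>k. of_bool (2 * int n - int k \<in> tail n N)) [1..<2 * n - 1] @ [0, 1]"
proof -
  have "{i. base_phi N i = 1} = phi_digits N" by (simp add: phi_digits_def)
  moreover have "Min (phi_digits N) = - 2 * int n" using assms by (simp add: set_Xi_list_iff_Min)
  ultimately have "beta_minus N = map (\<lambda>k. of_bool (- int k \<in> phi_digits N)) [1..<Suc (2 * n)]"
    unfolding beta_minus_def Let_def by (simp add: base_phi_eq nat_mult_distrib)
  also have "[1..<Suc (2 * n)] = [1..<2 * n - 1] @ [2 * n - 1, 2 * n]"
  proof -
    obtain m where "n = Suc m" using assms by (cases n) auto
    then show ?thesis by simp
  qed
  also have "map (\<lambda>k. of_bool (- int k \<in> phi_digits N)) \<dots>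
      = map (\<lambda>k. of_bool (2 * int n - int k \<in> tail n N)) [1..<2 * n - 1] @ [0, 1 :: nat]"
    using Xi_digits(1,2)[OF assms] assms(1) by (auto simp: tail_def of_nat_diff)
  finally show ?thesis .
qed

text \<open>Counted from the right, letter \<open>i\<close> of the shortened word belongs to tail
  index \<open>i + 2\<close>, exactly the Fibonacci index used by \<open>Z_inv\<close>.\<close>

lemma Z_inv_beta_minus:
  assumes "n \<ge> 1" "N \<in> set (Xi_list n)"
  shows "Z_inv (butlast (butlast (beta_minus N))) = (\<Sum>k\<in>tail n N. fib (nat k))"
proof -
  define e :: "nat list" where "e = map (\<lambda>k. of_bool (2 * int n - int k \<in> tail n N)) [1..<2 * n - 1]"
  have len: "length e = 2 * n - 2" by (simp add: e_def)
  have e: "rev e ! i = of_bool (int (i + 2) \<in> tail n N)" if "i < 2 * n - 2" for i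
    using that by (simp add: rev_nth len) (simp add: e_def of_nat_diff add.commute)
  have "Z_inv e = (\<Sum>i<2 * n - 2. of_bool (int (i + 2) \<in> tail n N) * fib (i + 2))"
    unfolding Z_inv_def len by (intro sum.cong) (auto simp: e)
  also have "\<dots> = (\<Sum>i | i < 2 * n - 2 \<and> int (i + 2) \<in> tail n N. fib (i + 2))"
    by (intro sum.mono_neutral_cong_right) auto
  also have "\<dots> = (\<Sum>k\<in>tail n N. fib (nat k))"
    using tail_subset[of n N]
    by (intro sum.reindex_bij_witness[of _ "\<lambda>k. nat (k - 2)" "\<lambda>i. int (i + 2)"])
       (auto simp: nat_diff_distrib' nat_add_distrib subset_iff simp del: fib.simps)
  finally have "Z_inv e = (\<Sum>k\<in>tail n N. fib (nat k))" .
  moreover have "butlast (butlast (beta_minus N)) = e"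
    using beta_minus_Xi[OF assms] by (simp add: e_def butlast_append)
  ultimately show ?thesis by simp
qed


section \<open>Fractional parts and Zeckendorf representations\<close>

lemma fib_golden: "real (fib k) * golden = real (fib (Suc k)) - psi ^ k"
proof (induction k rule: fib.induct)
  case (3 k)
  have "psi ^ Suc (Suc k) = psi ^ Suc k + psi ^ k"
    using psi_square by (simp add: algebra_simps flip: mult.assoc)
  then show ?case using 3 by (simp add: algebra_simps)
qed (auto simp: psi_def)

text \<open>Summing \<open>fib_golden\<close> and using \<open>golden = 2 - psi * psi\<close> shows
  that the difference is an integer. The right-hand side lies in (0, 1), because the sum over
  \<open>E\<close> is \<open>psi * psi * u\<close> with \<open>u\<close> between -1 and
  \<open>golden\<close>, and \<open>psi * psi - psi = 1\<close>.\<close>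

lemma frac_fib_sum:
  assumes "finite E" "E \<subseteq> {2..}"
  shows "frac (- real (Suc (\<Sum>k\<in>E. fib (nat k))) * golden) = psi * psi + pow_sum psi E"
proof -
  have "real (\<Sum>k\<in>E. fib (nat k)) * golden = (\<Sum>k\<in>E. real (fib (Suc (nat k))) - psi ^ nat k)"
    by (simp only: of_nat_sum sum_distrib_right fib_golden)
  also have "\<dots> = (\<Sum>k\<in>E. real (fib (Suc (nat k))) - psi powi k)"
    using assms(2) by (intro sum.cong) (auto simp: power_int_nonneg_exp subset_iff)
  also have "\<dots> = real (\<Sum>k\<in>E. fib (Suc (nat k))) - pow_sum psi E"
    by (simp add: sum_subtractf pow_sum_def)
  finally have "- real (Suc (\<Sum>k\<in>E. fib (nat k))) * golden - (psi * psi + pow_sum psi E)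
      = real_of_int (- int (\<Sum>k\<in>E. fib (Suc (nat k))) - 2)"
    by (simp add: algebra_simps psi_square) (simp add: psi_def)
  then have "- real (Suc (\<Sum>k\<in>E. fib (nat k))) * golden - (psi * psi + pow_sum psi E) \<in> \<int>"
    by (metis Ints_of_int)
  moreover obtain u where u: "pow_sum psi E = psi powi 2 * u" "- 1 < u" "u < golden"
    using pow_sum_psi_bounds[OF assms] by blast
  have "psi * psi * - 1 < psi * psi * u" "psi * psi * u < psi * psi * golden"
    by (rule mult_strict_left_mono; use u psi_square_bounds in simp)+
  moreover have "psi * psi * golden = - psi" using golden_psi by (metis mult.assoc mult.commute mult_minus1)
  ultimately show ?thesis
    unfolding frac_unique_iff using u(1) psi_square by (simp add: power2_eq_square)
qed

text \<open>As in \<open>pow_sum_golden_less\<close>: below the largest index \<open>j\<close> the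
  rest is less than \<open>fib (j - 1)\<close>, so the total stays below
  \<open>fib (j + 1)\<close>.\<close>

lemma zeckendorf_less:
  assumes "nonadj E" "E \<subseteq> {2..<int m}" "m \<ge> 1"
  shows "(\<Sum>k\<in>E. fib (nat k)) < fib m"
  using assms
proof (induction "card E" arbitrary: E m rule: less_induct)
  case less
  show ?case
  proof (cases "E = {}")
    case True
    then show ?thesis using less.prems by (simp add: fib_neq_0_nat)
  next
    case False
    define j where "j = Max E"
    have fin: "finite E" using less.prems by (simp add: nonadj_def)
    then have "j \<in> E" using False by (simp add: j_def)
    then have j: "j \<in> E" "2 \<le> j" "j < int m" using less.prems by auto
    have "E - {j} \<subseteq> {2..<int (nat (j - 1))}"
    proof
      fix i assume i: "i \<in> E - {j}"
      then have "i \<le> j" "i \<noteq> j" "i + 1 \<noteq> j" "2 \<le> i" using less.prems j fin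
        by (auto simp: nonadj_def j_def)
      then show "i \<in> {2..<int (nat (j - 1))}" by auto
    qed
    then have "(\<Sum>k\<in>E - {j}. fib (nat k)) < fib (nat (j - 1))"
      using j fin less.prems by (intro less.hyps card_Diff1_less) (auto intro: nonadj_subset)
    moreover have "(\<Sum>k\<in>E. fib (nat k)) = fib (nat j) + (\<Sum>k\<in>E - {j}. fib (nat k))"
      using fin j by (intro sum.remove)
    moreover have "fib (nat j) + fib (nat (j - 1)) = fib (Suc (nat j))"
    proof -
      obtain i where "nat j = Suc i" using j by (cases "nat j") auto
      then show ?thesis by (simp add: nat_diff_distrib)
    qed
    moreover have "fib (Suc (nat j)) \<le> fib m" using j by (intro fib_mono) auto
    ultimately show ?thesis by linarith
  qed
qed

text \<open>Greedy choice: if \<open>fib (m - 1)\<close> can be subtracted, less than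
  \<open>fib (m - 2)\<close> remains, and the next index is at most \<open>m - 3\<close>.\<close>

lemma zeckendorf_exists:
  assumes "c < fib m" "m \<ge> 1"
  shows "\<exists>E. nonadj E \<and> E \<subseteq> {2..<int m} \<and> (\<Sum>k\<in>E. fib (nat k)) = c"
  using assms
proof (induction m arbitrary: c rule: less_induct)
  case (less m)
  show ?case
  proof (cases "m \<le> 2")
    case True
    then have "c = 0" using less.prems fib_mono[of m 2] by simp
    then show ?thesis by (intro exI[of _ "{}"]) (auto simp: nonadj_def)
  next
    case False
    then obtain l where m: "m = Suc (Suc l)" "l \<ge> 1"
      by (intro that[of "m - 2"]) auto
    show ?thesis
    proof (cases "c < fib (Suc l)")
      case True
      then obtain E where "nonadj E" "E \<subseteq> {2..<int (Suc l)}" "(\<Sum>k\<in>E. fib (nat k)) = c"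
        using less.IH[of "Suc l" c] m by auto
      moreover from this(2) have "E \<subseteq> {2..<int m}" using m by auto
      ultimately show ?thesis by blast
    next
      case False
      then have "c - fib (Suc l) < fib l" using less.prems m by simp
      then obtain E where E: "nonadj E" "E \<subseteq> {2..<int l}" "(\<Sum>k\<in>E. fib (nat k)) = c - fib (Suc l)"
        using less.IH[of l "c - fib (Suc l)"] m by auto
      have notin: "int (Suc l) \<notin> E" using E by auto
      have "nonadj (insert (int (Suc l)) E)" using E by (auto simp: nonadj_def)
      moreover have "insert (int (Suc l)) E \<subseteq> {2..<int m}" using E m by auto
      moreover have "(\<Sum>k\<in>insert (int (Suc l)) E. fib (nat k)) = fib (Suc l) + (c - fib (Suc l))"
        using sum.insert[OF nonadj_finite[OF E(1)] notin, of "\<lambda>k. fib (nat k)"] E(3) by (simp only: nat_int)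
      ultimately show ?thesis using False by (metis add_diff_inverse_nat)
    qed
  qed
qed

section \<open>First occurrences and strictly sorted lists\<close>

lemma set_first_occurrences [simp]: "set (first_occurrences xs) = set xs"
  by (simp add: first_occurrences_def)

lemma first_occurrences_snoc:
  "first_occurrences (xs @ [x]) = (if x \<in> set xs then first_occurrences xs else first_occurrences xs @ [x])"
  by (simp add: first_occurrences_def)

text \<open>Appending a larger element either repeats a value or places a new value last. The
  relation compares one occurrence of \<open>u\<close> with all occurrences of \<open>v\<close>, so
  that a convenient occurrence of \<open>v\<close> can be inserted.\<close>

lemma first_occurrences_order:
  assumes "sorted_wrt (<) (xs :: 'a :: linorder list)"
  shows "sorted_wrt (\<lambda>u v. \<exists>x\<in>set xs. f x = u \<and> (\<forall>y\<in>set xs. f y = v \<longrightarrow> x < y))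
    (first_occurrences (map f xs))"
  using assms
proof (induction xs rule: rev_induct)
  case Nil
  then show ?case by (simp add: first_occurrences_def)
next
  case (snoc z xs)
  have less: "\<And>x. x \<in> set xs \<Longrightarrow> x < z" and "sorted_wrt (<) xs"
    using snoc.prems by (auto simp: sorted_wrt_append)
  let ?R = "\<lambda>u v. \<exists>x\<in>set (xs @ [z]). f x = u \<and> (\<forall>y\<in>set (xs @ [z]). f y = v \<longrightarrow> x < y)"
  have "sorted_wrt ?R (first_occurrences (map f xs))"
    using snoc.IH[OF \<open>sorted_wrt (<) xs\<close>] by (rule sorted_wrt_mono_rel[rotated]) (auto simp: less)
  moreover have "?R u (f z)" if "u \<in> f ` set xs" "f z \<notin> f ` set xs" for u
    
  proof -
    obtain x where x: "x \<in> set xs" "f x = u" using \<open>u \<in> f ` set xs\<close> by auto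
    moreover have "y = z" if "y \<in> set (xs @ [z])" "f y = f z" for y
      using that \<open>f z \<notin> f ` set xs\<close> by (auto dest: sym)
    ultimately show ?thesis using less[OF x(1)] by (intro bexI[of _ x]) auto
  qed
  ultimately show ?case by (auto simp: first_occurrences_snoc sorted_wrt_append)
qed

text \<open>Strictness makes the key injective on the entries, so the list is determined by its list
  of keys, and that list by its set.\<close>

lemma sorted_wrt_key_unique:
  fixes f :: "'a \<Rightarrow> 'b :: linorder"
  assumes "sorted_wrt (\<lambda>x y. f x < f y) xs" "sorted_wrt (\<lambda>x y. f x < f y) ys" "set xs = set ys"
  shows "xs = ys"
proof (rule map_inj_on)
  have *: "sorted_wrt (<) (map f xs)" "sorted_wrt (<) (map f ys)"
    using assms by (simp_all add: sorted_wrt_map)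
  then show "map f xs = map f ys"
    using assms(3) by (intro sorted_distinct_set_unique) (auto simp: strict_sorted_iff)
  have "inj_on f (set xs)" using *(1) by (simp add: strict_sorted_iff distinct_map)
  then show "inj_on f (set xs \<union> set ys)" using assms(3) by simp
qed

section \<open>Angles of the orbit points\<close>

text \<open>The integer part of \<open>- k * golden\<close> adds only full turns.\<close>

lemma Arg2pi_orbit_point: "Arg2pi (orbit_point k) = 2 * pi * frac (- real k * golden)"
proof (rule Arg2pi_unique[of 1])
  define x where "x = - real k * golden"
  have "exp (\<i> * of_real (2 * pi * x)) = exp (\<i> * of_real (2 * pi * frac x)) *
      exp (of_real (2 * of_int \<lfloor>x\<rfloor> * pi) * \<i>)"
    by (simp add: frac_def algebra_simps flip: exp_add)
  also have "exp (of_real (2 * of_int \<lfloor>x\<rfloor> * pi) * \<i>) = 1"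
    by (rule exp_integer_2pi) simp
  finally have "exp (\<i> * of_real (2 * pi * frac x)) = exp (\<i> * of_real (2 * pi * x))" by simp
  also have "\<dots> = orbit_point k" by (simp add: orbit_point_eq x_def algebra_simps)
  finally show "of_real 1 * exp (\<i> * of_real (2 * pi * frac (- real k * golden))) = orbit_point k"
    by (simp add: x_def)
qed (auto simp: frac_lt_1)

lemma angle_ordering_iff:
  "angle_ordering m ks \<longleftrightarrow> length ks = m \<and> set ks = {1..m} \<and>
     sorted_wrt (\<lambda>k l. frac (- real k * golden) < frac (- real l * golden)) ks"
  by (simp add: angle_ordering_def Arg2pi_orbit_point)

section \<open>Comparison of the two orders\<close>

lemma frac_Z_inv_beta_minus:
  assumes "n \<ge> 1" "N \<in> set (Xi_list n)"
  shows "frac (- real (Suc (Z_inv (butlast (butlast (beta_minus N))))) * golden)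
      = psi * psi + pow_sum psi (tail n N)"
proof -
  have "tail n N \<subseteq> {2..}" using tail_subset by force
  then show ?thesis
    by (simp only: Z_inv_beta_minus[OF assms] frac_fib_sum[OF nonadj_finite[OF nonadj_tail]])
qed

lemma sorted_Pi_beta:
  assumes "n \<ge> 1"
  shows "sorted_wrt (\<lambda>k l. frac (- real k * golden) < frac (- real l * golden)) (map Suc (Pi_beta n))"
proof -
  define key where "key w = frac (- real (Suc (Z_inv (butlast (butlast w)))) * golden)" for w
  define ws where "ws = first_occurrences (map beta_minus (Xi_list n))"
  have "sorted_wrt (\<lambda>u v. key u < key v) ws"
  proof (rule sorted_wrt_mono_rel)
    show "sorted_wrt (\<lambda>u v. \<exists>x\<in>set (Xi_list n). beta_minus x = u \<and>
        (\<forall>y\<in>set (Xi_list n). beta_minus y = v \<longrightarrow> x < y)) ws"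
      unfolding ws_def by (rule first_occurrences_order) (simp add: Xi_list_def del: upt_Suc)
  next
    fix u v
    assume v: "v \<in> set ws"
      and "\<exists>x\<in>set (Xi_list n). beta_minus x = u \<and> (\<forall>y\<in>set (Xi_list n). beta_minus y = v \<longrightarrow> x < y)"
    then obtain N where N: "N \<in> set (Xi_list n)" "beta_minus N = u"
      and first: "\<And>y. y \<in> set (Xi_list n) \<Longrightarrow> beta_minus y = v \<Longrightarrow> N < y" by blast
    obtain N' where N': "N' \<in> set (Xi_list n)" "beta_minus N' = v" using v by (auto simp: ws_def)
    \<comment> \<open>\<open>M\<close> is an early representative of the word \<open>v\<close>:
      equal tails give equal words, so \<open>first\<close> applies to it.\<close>
    obtain M where M: "M \<in> set (Xi_list n)" "tail n M = tail n N'"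
      "real M \<le> golden ^ (2 * n) * (1 + pow_sum psi (tail n N'))"
      using tail_realized[OF assms nonadj_tail tail_subset] by blast
    have "beta_minus M = v"
      using N' M by (simp add: beta_minus_Xi[OF assms])
    then have "N < M" using first M by blast
    \<comment> \<open>The value B of \<open>u\<close> is below \<open>N + 1\<close>, which is at
      most \<open>M\<close> by integrality, and \<open>M\<close> is at most the value B of
      \<open>v\<close>.\<close>
    then have "golden ^ (2 * n) * (1 + pow_sum psi (tail n N))
        < golden ^ (2 * n) * (1 + pow_sum psi (tail n N'))"
      using tail_upper_bound[OF assms N(1)] M(3) by linarith
    then have "pow_sum psi (tail n N) < pow_sum psi (tail n N')"
      by (simp add: mult_less_cancel_left_pos)
    then show "key u < key v"
      using frac_Z_inv_beta_minus[OF assms N(1)] frac_Z_inv_beta_minus[OF assms N'(1)] N(2) N'(2)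
      by (simp add: key_def)
  qed
  then show ?thesis by (simp only: Pi_beta_def sorted_wrt_map key_def ws_def)
qed

text \<open>By \<open>tail_realized\<close> every nonadjacent subset of the index range is a tail,
  so the Zeckendorf sums fill the whole initial segment.\<close>

lemma set_Pi_beta:
  assumes "n \<ge> 1"
  shows "set (Pi_beta n) = {..<fib (2 * n)}"
proof -
  have "set (Pi_beta n) = (\<lambda>N. \<Sum>k\<in>tail n N. fib (nat k)) ` set (Xi_list n)"
    by (auto simp: Pi_beta_def Z_inv_beta_minus[OF assms] image_image intro!: image_cong)
  also have "\<dots> = {..<fib (2 * n)}"
  proof (intro equalityI subsetI)
    fix c assume "c \<in> (\<lambda>N. \<Sum>k\<in>tail n N. fib (nat k)) ` set (Xi_list n)"
    then show "c \<in> {..<fib (2 * n)}"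
      using zeckendorf_less[OF nonadj_tail, of n _ "2 * n"] tail_subset assms by auto
  next
    fix c assume "c \<in> {..<fib (2 * n)}"
    then obtain E where E: "nonadj E" "E \<subseteq> {2..<2 * int n}" "(\<Sum>k\<in>E. fib (nat k)) = c"
      using zeckendorf_exists[of c "2 * n"] assms by auto
    obtain M where "M \<in> set (Xi_list n)" "tail n M = E" using tail_realized[OF assms E(1,2)] by blast
    with E(3) show "c \<in> (\<lambda>N. \<Sum>k\<in>tail n N. fib (nat k)) ` set (Xi_list n)" by force
  qed
  finally show ?thesis .
qed

theorem theorem7p7:
  fixes n :: nat
  assumes "n \<ge> 1"
  shows "length (Pi_beta n) = fib (2 * n) \<and>
    (\<exists>!ks. angle_ordering (fib (2 * n)) ks) \<and>
    (\<forall>ks. angle_ordering (fib (2 * n)) ks \<longrightarrow>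
       sorted_wrt (\<lambda>k l. frac (- real k * golden) < frac (- real l * golden)) ks \<and>
       (\<forall>j < fib (2 * n). int (Pi_beta n ! j) = int (ks ! j) - 1))"
proof -
  let ?ks = "map Suc (Pi_beta n)"
  note sorted = sorted_Pi_beta[OF assms]
  have "sorted_wrt (<) (map (\<lambda>k. frac (- real k * golden)) ?ks)"
    using sorted by (simp only: sorted_wrt_map)
  \<comment> \<open>Strict order of the fractional parts rules out repetitions, so the length can be
    read off from the set of entries.\<close>
  then have "distinct (Pi_beta n)"
    by (simp add: strict_sorted_iff distinct_map)
  then have length: "length (Pi_beta n) = fib (2 * n)"
    using distinct_card[of "Pi_beta n"] set_Pi_beta[OF assms] by simp
  have "set ?ks = {1..fib (2 * n)}"
    by (simp add: set_Pi_beta[OF assms] image_Suc_lessThan)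
  then have "angle_ordering (fib (2 * n)) ks \<longleftrightarrow> ks = ?ks" for ks
    using sorted length sorted_wrt_key_unique[of "\<lambda>k. frac (- real k * golden)" ks ?ks]
    unfolding angle_ordering_iff by auto
  then show ?thesis using sorted length by auto
qed

end
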